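(* Let $k\ge1$ be an integer, let $\mathcal{X},\mathcal{Y}$ be finite sets, and let $\mathbf{X}=(X_n)_{n\in\mathbb{N}_0}$ be a stationary stochastic process on the finite alphabet $\mathcal{X}$. Let $g:\mathcal{X}\to\mathcal{Y}$ be a function. Define $\mathbf{Y}=(Y_n)_{n\in\mathbb{N}_0}$ by $Y_n=g(X_n)$, and let $\mathbf{Z}$, with transition matrix $\mathbf{Q}$, be the $k$-th order Markov approximation of $\mathbf{Y}$. If the $k$-th order Markov approximation $\mathbf{M}$ of $\mathbf{X}$ is such that the first-order Markov chain $\mathbf{M}^{(k)}$ on $\mathcal{X}^k$ has a single recurrent class, then $\mathbf{Z}$ has a unique invariant distribution $\mu$ on $\mathcal{Y}^k$.
   Context: Notation: $z_a^b=(z_a,\dots,z_b)$, and similarly for random variables; $p_Z(z)=\mathbb{P}(Z=z)$, and $p_{Z_1|Z_2}$ denotes conditional probabilities. Markov chains: A $k$-th order homogeneous Markov chain $\mathbf{Z}=(Z_n)_{n\in\mathbb{N}_0}$ on a finite alphabet $\mathcal{Z}$ with transition matrix $\mathbf{Q}$ (a $|\mathcal{Z}|^k\times|\mathcal{Z}|$ row-stochastic matrix with entries $Q_{z_0^{k-1}\to z_k}$) is a process with $p_{Z_n|Z_0^{n-1}}(z_n|z_0^{n-1})=p_{Z_n|Z_{n-k}^{n-1}}(z_n|z_{n-k}^{n-1})=Q_{z_{n-k}^{n-1}\to z_n}$ for all $n\ge k$ and all $z_0^n\in\mathcal{Z}^{n+1}$. Lifted chain: For such a chain, $\mathbf{Z}^{(k)}=(Z_n^{n+k-1})_{n\in\mathbb{N}_0}$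 is the first-order homogeneous Markov chain on $\mathcal{Z}^k$ whose transition probability from ${z'}_0^{k-1}$ to $z_0^{k-1}$ equals $Q_{{z'}_0^{k-1}\to z_{k-1}}$ if $z'_1=z_0,\dots,z'_{k-1}=z_{k-2}$, and $0$ otherwise. Recurrent classes of a first-order chain: $z$ is accessible from $z'$ ($z'\to z$) if some $n\ge1$ has $n$-step transition probability from $z'$ to $z$ positive; $z,z'$ communicate if $z\to z'$ and $z'\to z$; $z$ is recurrent if $z\to z'$ implies $z'\to z$, and transient otherwise; a recurrent class is a communication class of recurrent states. Invariant distribution: A probability distribution $\mu$ on $\mathcal{Z}^k$ is invariant for a $k$-th order chain with transition matrix $\mathbf{Q}$ if and only if for all $z_1^k\in\mathcal{Z}^k$: $\mu_{z_1^k}=\sum_{z_0\in\mathcal{Z}}\mu_{z_0^{k-1}}Q_{z_0^{k-1}\to z_k}$. Markov approximation: For a stationary process $\mathbf{W}$ on a finite alphabet $\mathcal{Z}$, its $k$-th order Markov approximation is a $k$-th order homogeneous Markov chain on $\mathcal{Z}$ with transition matrix $\mathbf{Q}$ given, for all $z_0^k\in\mathcal{Z}^{k+1}$, by $Q_{z_0^{k-1}\to z_k}=p_{W_0^k}(z_0^k)/p_{W_0^{k-1}}(z_0^{k-1})$ if $p_{W_0^{k-1}}(z_0^{k-1})>0$, and $Q_{z_0^{k-1}\to z_k}=1/|\mathcal{Z}|$ otherwise. *)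

theory Defs
  imports "HOL-Probability.Probability"
begin

section \<open>Words and processes on a finite alphabet\<close>

definition words :: "'a set \<Rightarrow> nat \<Rightarrow> 'a list set" where
  "words A k = {w. set w \<subseteq> A \<and> length w = k}"

text \<open>Half-open indexing: \<open>block V a b\<close> is \<open>(V\<^sub>a, \<dots>, V\<^sub>b\<^sub>-\<^sub>1)\<close>,
  so that no truncated subtraction is needed for \<open>V\<^sub>0, \<dots>, V\<^sub>n\<^sub>-\<^sub>1\<close>.\<close>

definition block :: "(nat \<Rightarrow> 'w \<Rightarrow> 'a) \<Rightarrow> nat \<Rightarrow> nat \<Rightarrow> 'w \<Rightarrow> 'a list" where
  "block V a b \<omega> = map (\<lambda>i. V i \<omega>) [a..<b]"

definition process :: "'w measure \<Rightarrow> 'a set \<Rightarrow> (nat \<Rightarrow> 'w \<Rightarrow> 'a) \<Rightarrow> bool" where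
  "process P A V \<longleftrightarrow> prob_space P \<and> (\<forall>n. V n \<in> P \<rightarrow>\<^sub>M count_space A)"

definition stationary_process :: "'w measure \<Rightarrow> 'a set \<Rightarrow> (nat \<Rightarrow> 'w \<Rightarrow> 'a) \<Rightarrow> bool" where
  "stationary_process P A V \<longleftrightarrow> process P A V \<and>
     (\<forall>m n. \<forall>w\<in>words A n.
        \<P>(\<omega> in P. block V m (m + n) \<omega> = w) = \<P>(\<omega> in P. block V 0 n \<omega> = w))"

section \<open>Markov chains of order \<open>k\<close>\<close>

text \<open>Transition matrices are functions; only the entries \<open>Q u a\<close> with \<open>u \<in> words A k\<close> and
  \<open>a \<in> A\<close> matter.\<close>

definition row_stochastic :: "'a set \<Rightarrow> nat \<Rightarrow> ('a list \<Rightarrow> 'a \<Rightarrow> real) \<Rightarrow> bool" where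
  "row_stochastic A k Q \<longleftrightarrow>
     (\<forall>u\<in>words A k. (\<forall>a\<in>A. 0 \<le> Q u a) \<and> (\<Sum>a\<in>A. Q u a) = 1)"

text \<open>The conditional probabilities are constrained only when the conditioning event has positive
  probability; \<open>cond_prob\<close> is \<open>0\<close> otherwise. The initial distribution is arbitrary.\<close>

definition markov_chain ::
  "'w measure \<Rightarrow> 'a set \<Rightarrow> nat \<Rightarrow> ('a list \<Rightarrow> 'a \<Rightarrow> real) \<Rightarrow> (nat \<Rightarrow> 'w \<Rightarrow> 'a) \<Rightarrow> bool" where
  "markov_chain P A k Q V \<longleftrightarrow> process P A V \<and> row_stochastic A k Q \<and>
     (\<forall>n\<ge>k. \<forall>u\<in>words A n. \<forall>a\<in>A.
        \<P>(\<omega> in P. block V 0 n \<omega> = u) > 0 \<longrightarrow>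
          \<P>(\<omega> in P. V n \<omega> = a \<bar> block V 0 n \<omega> = u)
            = \<P>(\<omega> in P. V n \<omega> = a \<bar> block V (n - k) n \<omega> = drop (n - k) u) \<and>
          \<P>(\<omega> in P. V n \<omega> = a \<bar> block V (n - k) n \<omega> = drop (n - k) u)
            = Q (drop (n - k) u) a)"

text \<open>Here \<open>w = (z\<^sub>1, \<dots>, z\<^sub>k)\<close>, so \<open>a # butlast w = (a, z\<^sub>1, \<dots>, z\<^sub>k\<^sub>-\<^sub>1)\<close>. Carrying \<open>\<mu>\<close> as a \<open>pmf\<close>
  supported on \<open>words A k\<close> makes its values off \<open>words A k\<close> irrelevant for uniqueness.\<close>

definition invariant_distribution ::
  "'a set \<Rightarrow> nat \<Rightarrow> ('a list \<Rightarrow> 'a \<Rightarrow> real) \<Rightarrow> 'a list pmf \<Rightarrow> bool" where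
  "invariant_distribution A k Q \<mu> \<longleftrightarrow> set_pmf \<mu> \<subseteq> words A k \<and>
     (\<forall>w\<in>words A k.
        pmf \<mu> w = (\<Sum>a\<in>A. pmf \<mu> (a # butlast w) * Q (a # butlast w) (last w)))"

definition approx_matrix ::
  "'w measure \<Rightarrow> 'a set \<Rightarrow> nat \<Rightarrow> (nat \<Rightarrow> 'w \<Rightarrow> 'a) \<Rightarrow> 'a list \<Rightarrow> 'a \<Rightarrow> real" where
  "approx_matrix P A k W u a =
     (if \<P>(\<omega> in P. block W 0 k \<omega> = u) > 0
      then \<P>(\<omega> in P. block W 0 (k + 1) \<omega> = u @ [a]) / \<P>(\<omega> in P. block W 0 k \<omega> = u)
      else 1 / real (card A))"

text \<open>\<open>V\<close>, on its own probability space \<open>P'\<close> and with transition matrix \<open>Q\<close>, is a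
  Markov approximation of order \<open>k\<close> of the process \<open>W\<close> on \<open>P\<close>.\<close>

definition markov_approximation ::
  "'w measure \<Rightarrow> 'a set \<Rightarrow> nat \<Rightarrow> (nat \<Rightarrow> 'w \<Rightarrow> 'a) \<Rightarrow>
   'v measure \<Rightarrow> ('a list \<Rightarrow> 'a \<Rightarrow> real) \<Rightarrow> (nat \<Rightarrow> 'v \<Rightarrow> 'a) \<Rightarrow> bool" where
  "markov_approximation P A k W P' Q V \<longleftrightarrow> markov_chain P' A k Q V \<and>
     (\<forall>u\<in>words A k. \<forall>a\<in>A. Q u a = approx_matrix P A k W u a)"

section \<open>Lifted chain and recurrent classes\<close>

text \<open>Transition probabilities on \<open>words A k\<close> of the first-order chain
  \<open>(V\<^sub>n, \<dots>, V\<^sub>n\<^sub>+\<^sub>k\<^sub>-\<^sub>1)\<close>, \<open>n \<ge> 0\<close>, for a chain \<open>V\<close> of order \<open>k \<ge> 1\<close> with transition matrix \<open>Q\<close>.\<close>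

definition lifted_matrix :: "('a list \<Rightarrow> 'a \<Rightarrow> real) \<Rightarrow> 'a list \<Rightarrow> 'a list \<Rightarrow> real" where
  "lifted_matrix Q u v = (if tl u = butlast v then Q u (last v) else 0)"

text \<open>In the following, \<open>T x y\<close> is the probability of a transition from \<open>x\<close> to \<open>y\<close> of a
  first-order chain with state space \<open>S\<close>.\<close>

primrec nstep :: "'s set \<Rightarrow> ('s \<Rightarrow> 's \<Rightarrow> real) \<Rightarrow> nat \<Rightarrow> 's \<Rightarrow> 's \<Rightarrow> real" where
  "nstep S T 0 x y = (if x = y then 1 else 0)"
| "nstep S T (Suc n) x y = (\<Sum>z\<in>S. T x z * nstep S T n z y)"

definition accessible :: "'s set \<Rightarrow> ('s \<Rightarrow> 's \<Rightarrow> real) \<Rightarrow> 's \<Rightarrow> 's \<Rightarrow> bool" where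
  "accessible S T x y \<longleftrightarrow> (\<exists>n\<ge>1. nstep S T n x y > 0)"

definition communicate :: "'s set \<Rightarrow> ('s \<Rightarrow> 's \<Rightarrow> real) \<Rightarrow> 's \<Rightarrow> 's \<Rightarrow> bool" where
  "communicate S T x y \<longleftrightarrow> accessible S T x y \<and> accessible S T y x"

definition recurrent :: "'s set \<Rightarrow> ('s \<Rightarrow> 's \<Rightarrow> real) \<Rightarrow> 's \<Rightarrow> bool" where
  "recurrent S T x \<longleftrightarrow> (\<forall>y\<in>S. accessible S T x y \<longrightarrow> accessible S T y x)"

definition recurrent_class :: "'s set \<Rightarrow> ('s \<Rightarrow> 's \<Rightarrow> real) \<Rightarrow> 's set \<Rightarrow> bool" where
  "recurrent_class S T C \<longleftrightarrow>
     (\<exists>x\<in>S. recurrent S T x \<and> C = {y\<in>S. communicate S T x y})"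

end

theory Submission
  imports Defs
begin

text \<open>
  Existence: the law of the first \<open>k\<close> letters of a stationary process is invariant for its
  Markov approximation of order \<open>k\<close>
  (\<open>stationary_invariant_distribution_exists\<close>), and \<open>Y\<close>
  inherits stationarity from \<open>X\<close>.

  Uniqueness: a finite chain has at most one invariant distribution as soon as some state can be
  reached from every state (\<open>invariant_unique\<close>). Indeed, the difference of two invariant
  distributions has total mass zero; if it does not vanish, its positive and negative parts are both
  nonzero, and both are invariant, so both would be positive at the common reachable state.

  Such a state of the lifted chain of \<open>Z\<close> comes from the lifted chain of \<open>M\<close>. There, having
  a single recurrent class yields a word \<open>x0\<close> reachable from every word
  (\<open>single_recurrent_class_reachable\<close>), and \<open>map g x0\<close> does the job. From any word over the
  alphabet of \<open>Y\<close>, the uniform rows at words of probability zero lead to a word of positive probability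
  under the law of \<open>Y\<close> (\<open>support_reachable\<close>). That word is the image of some word \<open>u\<close> of
  positive probability under the law of \<open>X\<close>. A path from \<open>u\<close> to \<open>x0\<close> stays inside the support
  of the law of \<open>X\<close>, where all transitions are witnessed by blocks of \<open>X\<close> with positive
  probability, and applying \<open>g\<close> to these blocks turns the path into one of the lifted chain of
  \<open>Z\<close> (\<open>support_edge_image\<close>). The restriction to the support matters: outside of it, a transition
  of the approximation of \<open>X\<close> need not project to one of the approximation of \<open>Y\<close>.
\<close>

section \<open>Reachability and uniqueness of invariant vectors on a finite state space\<close>

definition edges :: "'s set \<Rightarrow> ('s \<Rightarrow> 's \<Rightarrow> real) \<Rightarrow> ('s \<times> 's) set" where
  "edges S T = {(x, y). x \<in> S \<and> y \<in> S \<and> 0 < T x y}"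

lemma nstep_nonneg:
  assumes "\<And>x y. x \<in> S \<Longrightarrow> y \<in> S \<Longrightarrow> 0 \<le> T x y" "x \<in> S"
  shows "0 \<le> nstep S T n x y"
  using assms(2) by (induction n arbitrary: x) (auto intro!: sum_nonneg mult_nonneg_nonneg assms(1))

lemma nstep_Suc_pos_iff:
  assumes "finite S" "\<And>x y. x \<in> S \<Longrightarrow> y \<in> S \<Longrightarrow> 0 \<le> T x y" "x \<in> S"
  shows "0 < nstep S T (Suc n) x y \<longleftrightarrow> (\<exists>z. (x, z) \<in> edges S T \<and> 0 < nstep S T n z y)"
proof
  assume "0 < nstep S T (Suc n) x y"
  then have "\<not> (\<Sum>z\<in>S. T x z * nstep S T n z y) \<le> 0" by simp
  then obtain z where z: "z \<in> S" "T x z * nstep S T n z y > 0"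
    using sum_nonpos[of S "\<lambda>z. T x z * nstep S T n z y"] by force
  then have "0 < T x z" "0 < nstep S T n z y"
    using assms(2)[OF assms(3) z(1)] by (auto simp: zero_less_mult_iff)
  then show "\<exists>z. (x, z) \<in> edges S T \<and> 0 < nstep S T n z y"
    using z assms(3) by (auto simp: edges_def)
next
  assume "\<exists>z. (x, z) \<in> edges S T \<and> 0 < nstep S T n z y"
  then obtain z where z: "z \<in> S" "0 < T x z" "0 < nstep S T n z y"
    by (auto simp: edges_def)
  show "0 < nstep S T (Suc n) x y"
    unfolding nstep.simps
  proof (rule sum_pos2[OF assms(1) z(1)])
    show "0 \<le> T x v * nstep S T n v y" if "v \<in> S" for v
      by (intro mult_nonneg_nonneg assms(2) nstep_nonneg assms(3) that)
  qed (use z in simp)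
qed

lemma accessible_iff_trancl:
  assumes "finite S" "\<And>x y. x \<in> S \<Longrightarrow> y \<in> S \<Longrightarrow> 0 \<le> T x y" "x \<in> S"
  shows "accessible S T x y \<longleftrightarrow> (x, y) \<in> (edges S T)\<^sup>+"
proof -
  have step: "0 < nstep S T n x y \<longleftrightarrow> (x, y) \<in> edges S T ^^ n" if "x \<in> S" for n x
    using that
  proof (induction n arbitrary: x)
    case (Suc n)
    have "0 < nstep S T (Suc n) x y \<longleftrightarrow> (\<exists>z. (x, z) \<in> edges S T \<and> (z, y) \<in> edges S T ^^ n)"
      using nstep_Suc_pos_iff[of S T x n y, OF assms(1,2) Suc.prems] Suc.IH
      by (auto simp: edges_def simp del: nstep.simps)
    also have "\<dots> \<longleftrightarrow> (x, y) \<in> edges S T ^^ Suc n"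
      by (metis relpow_Suc_D2 relpow_Suc_I2)
    finally show ?case .
  qed auto
  show ?thesis
    unfolding accessible_def step[OF assms(3)]
    by (metis One_nat_def Suc_le_eq trancl_power)
qed

text \<open>Among the states reachable from \<open>x\<close>, choose \<open>y\<close> with the fewest reachable states. By
  minimality, every state reachable from \<open>y\<close> reaches exactly the same states as \<open>y\<close>, so all of
  them are recurrent. Thus every \<open>x\<close> reaches some recurrent state, and with a single recurrent
  class every \<open>x\<close> reaches all of that class.\<close>

lemma single_recurrent_class_reachable:
  assumes fin: "finite S" and nonneg: "\<And>x y. x \<in> S \<Longrightarrow> y \<in> S \<Longrightarrow> 0 \<le> T x y"
    and exit: "\<And>x. x \<in> S \<Longrightarrow> \<exists>y\<in>S. 0 < T x y"
    and single: "\<exists>!C. recurrent_class S T C"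
  shows "\<exists>x0\<in>S. \<forall>x\<in>S. (x, x0) \<in> (edges S T)\<^sup>+"
proof -
  let ?E = "edges S T"
  define reach where "reach x = {y \<in> S. (x, y) \<in> ?E\<^sup>+}" for x
  have acc: "accessible S T x y \<longleftrightarrow> (x, y) \<in> ?E\<^sup>+" if "x \<in> S" for x y
    by (rule accessible_iff_trancl[OF fin nonneg that])
  have reach_trans: "w \<in> reach u" if "v \<in> reach u" "w \<in> reach v" for u v w
  proof -
    have "(u, v) \<in> ?E\<^sup>+" "(v, w) \<in> ?E\<^sup>+" "w \<in> S" using that by (simp_all add: reach_def)
    from trancl_trans[OF this(1,2)] this(3) show ?thesis by (simp add: reach_def)
  qed
  have rec: "\<exists>z\<in>reach x. recurrent S T z \<and> communicate S T z z" if x: "x \<in> S" for x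
  proof -
    have nonempty: "reach y \<noteq> {}" if y: "y \<in> S" for y
    proof -
      obtain z where "z \<in> S" "(y, z) \<in> ?E" using exit[OF y] y by (auto simp: edges_def)
      then have "z \<in> reach y" by (simp add: reach_def r_into_trancl)
      then show ?thesis by blast
    qed
    obtain y where y: "y \<in> reach x" "\<And>z. z \<in> reach x \<Longrightarrow> card (reach y) \<le> card (reach z)"
    proof -
      obtain y where "y \<in> reach x" using nonempty[OF x] by blast
      from ex_has_least_nat[of "\<lambda>y. y \<in> reach x", OF this, of "\<lambda>y. card (reach y)"]
      show thesis by (elim exE conjE) (rule that, auto)
    qed
    have eq: "reach z = reach y" if "z \<in> reach y" for z
    proof -
      have "reach z \<subseteq> reach y" "z \<in> reach x"
        using reach_trans[OF that] reach_trans[OF y(1) that] by blast+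
      moreover have "finite (reach y)" using fin by (simp add: reach_def)
      ultimately show ?thesis using y(2)[of z] card_seteq by metis
    qed
    have "y \<in> S" using y(1) by (simp add: reach_def)
    then obtain z where z: "z \<in> reach y" using nonempty by blast
    \<comment> \<open>The state \<open>y\<close> itself may be transient, but any \<open>z\<close> reachable from it can be
      reached again from wherever \<open>z\<close> leads.\<close>
    have return: "z \<in> reach u" if "u \<in> reach z" for u
      using eq[OF z] eq[of u] that z by blast
    have "z \<in> S" using z by (simp add: reach_def)
    moreover have "recurrent S T z"
      unfolding recurrent_def
    proof (intro ballI impI)
      fix u assume "u \<in> S" "accessible S T z u"
      then have "z \<in> reach u" using acc[OF \<open>z \<in> S\<close>] by (intro return) (simp add: reach_def)
      then show "accessible S T u z" using acc[OF \<open>u \<in> S\<close>] by (simp add: reach_def)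
    qed
    moreover have "communicate S T z z"
    proof -
      have "z \<in> reach z" using eq[OF z] z by simp
      then show ?thesis using acc[OF \<open>z \<in> S\<close>] by (simp add: communicate_def reach_def)
    qed
    moreover have "z \<in> reach x"
      by (rule reach_trans[OF y(1) z])
    ultimately show ?thesis by blast
  qed
  obtain C where C: "recurrent_class S T C" and C_eq: "\<And>C'. recurrent_class S T C' \<Longrightarrow> C' = C"
    using single by blast
  obtain x0 where x0: "x0 \<in> S" "C = {y \<in> S. communicate S T x0 y}"
    using C by (auto simp: recurrent_class_def)
  have "(x, x0) \<in> ?E\<^sup>+" if x: "x \<in> S" for x
  proof -
    obtain z where z: "z \<in> reach x" "recurrent S T z" "communicate S T z z"
      using rec[OF x] by blast
    then have zS: "z \<in> S" by (simp add: reach_def)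
    have "recurrent_class S T {y \<in> S. communicate S T z y}"
      unfolding recurrent_class_def using zS z(2) by (intro bexI[of _ z] conjI refl)
    note eqC = C_eq[OF this]
    have "z \<in> C" using z(3) zS by (simp flip: eqC)
    then have "accessible S T z x0" using x0(2) by (simp add: communicate_def)
    then have "(z, x0) \<in> ?E\<^sup>+" using acc[OF zS] by simp
    moreover have "(x, z) \<in> ?E\<^sup>+" using z(1) by (simp add: reach_def)
    ultimately show ?thesis by (rule trancl_trans[rotated])
  qed
  then show ?thesis using x0(1) by blast
qed

text \<open>The triangle inequality gives \<open>\<bar>d\<bar> \<le> \<bar>d\<bar> T\<close>, and both sides have the same total mass, so
  \<open>\<bar>d\<bar>\<close> is invariant too. Hence so is twice the positive part, \<open>\<bar>d\<bar> + d\<close>; its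
  positivity spreads along the edges.\<close>

lemma invariant_positive_spreads:
  fixes d :: "'s \<Rightarrow> real"
  assumes fin: "finite S" and nonneg: "\<And>x y. x \<in> S \<Longrightarrow> y \<in> S \<Longrightarrow> 0 \<le> T x y"
    and stoch: "\<And>x. x \<in> S \<Longrightarrow> (\<Sum>y\<in>S. T x y) = 1"
    and inv: "\<And>y. y \<in> S \<Longrightarrow> d y = (\<Sum>x\<in>S. d x * T x y)"
    and path: "(x, y) \<in> (edges S T)\<^sup>*" and pos: "0 < d x" "x \<in> S"
  shows "0 < d y"
proof -
  have le: "\<bar>d y\<bar> \<le> (\<Sum>x\<in>S. \<bar>d x\<bar> * T x y)" if y: "y \<in> S" for y
  proof -
    have "\<bar>d y\<bar> \<le> (\<Sum>x\<in>S. \<bar>d x * T x y\<bar>)"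
      unfolding inv[OF y] by (rule sum_abs)
    also have "\<dots> = (\<Sum>x\<in>S. \<bar>d x\<bar> * T x y)"
      by (rule sum.cong) (auto simp: abs_mult nonneg y)
    finally show ?thesis .
  qed
  have "(\<Sum>y\<in>S. \<Sum>x\<in>S. \<bar>d x\<bar> * T x y) = (\<Sum>x\<in>S. \<bar>d x\<bar> * (\<Sum>y\<in>S. T x y))"
    by (subst sum.swap) (simp add: sum_distrib_left)
  also have "\<dots> = (\<Sum>y\<in>S. \<bar>d y\<bar>)"
    by (simp add: stoch)
  finally have "(\<Sum>y\<in>S. (\<Sum>x\<in>S. \<bar>d x\<bar> * T x y) - \<bar>d y\<bar>) = 0"
    by (simp add: sum_subtractf)
  then have abs_inv: "\<bar>d y\<bar> = (\<Sum>x\<in>S. \<bar>d x\<bar> * T x y)" if "y \<in> S" for y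
    using sum_nonneg_0[OF fin, of "\<lambda>y. (\<Sum>x\<in>S. \<bar>d x\<bar> * T x y) - \<bar>d y\<bar>" y] le that by simp
  define e where "e y = \<bar>d y\<bar> + d y" for y
  have e_inv: "e y = (\<Sum>x\<in>S. e x * T x y)" if "y \<in> S" for y
    unfolding e_def using abs_inv[OF that] inv[OF that]
    by (simp add: distrib_right sum.distrib)
  have "0 < e y"
    using path
  proof (induction rule: rtrancl_induct)
    case base
    show ?case using pos by (simp add: e_def)
  next
    case (step y z)
    then have yz: "y \<in> S" "z \<in> S" "0 < T y z" by (auto simp: edges_def)
    have "0 < (\<Sum>x\<in>S. e x * T x z)"
      by (rule sum_pos2[OF fin yz(1)]) (use step yz nonneg in \<open>auto simp: e_def\<close>)
    then show ?case using e_inv[OF yz(2)] by simp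
  qed
  then show ?thesis by (auto simp: e_def)
qed

lemma invariant_unique:
  fixes p q :: "'s \<Rightarrow> real"
  assumes fin: "finite S" and nonneg: "\<And>x y. x \<in> S \<Longrightarrow> y \<in> S \<Longrightarrow> 0 \<le> T x y"
    and stoch: "\<And>x. x \<in> S \<Longrightarrow> (\<Sum>y\<in>S. T x y) = 1"
    and reach: "\<And>x. x \<in> S \<Longrightarrow> (x, x0) \<in> (edges S T)\<^sup>*"
    and p_inv: "\<And>y. y \<in> S \<Longrightarrow> p y = (\<Sum>x\<in>S. p x * T x y)"
    and q_inv: "\<And>y. y \<in> S \<Longrightarrow> q y = (\<Sum>x\<in>S. q x * T x y)"
    and mass: "sum p S = sum q S" and x: "x \<in> S"
  shows "p x = q x"
proof -
  have no_excess: "p' x \<le> q' x"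
    if inv: "\<And>y. y \<in> S \<Longrightarrow> p' y = (\<Sum>x\<in>S. p' x * T x y)"
      "\<And>y. y \<in> S \<Longrightarrow> q' y = (\<Sum>x\<in>S. q' x * T x y)"
      and mass': "sum p' S = sum q' S" for p' q' :: "'s \<Rightarrow> real"
  proof (rule ccontr)
    assume less: "\<not> p' x \<le> q' x"
    \<comment> \<open>By equality of the masses an excess at \<open>x\<close> forces a deficit at some \<open>z\<close>; both spread
      to \<open>x0\<close>.\<close>
    obtain z where z: "z \<in> S" "p' z < q' z"
      using sum_strict_mono_ex1[OF fin, of q' p'] less x mass'
      by (metis leI less_irrefl not_le)
    have "0 < p' x0 - q' x0"
      by (rule invariant_positive_spreads[OF fin nonneg stoch _ reach[OF x] _ x])
         (use less inv in \<open>auto simp: left_diff_distrib sum_subtractf\<close>)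
    moreover have "0 < q' x0 - p' x0"
      by (rule invariant_positive_spreads[OF fin nonneg stoch _ reach[OF z(1)] _ z(1)])
         (use z inv in \<open>auto simp: left_diff_distrib sum_subtractf\<close>)
    ultimately show False by simp
  qed
  show ?thesis
    using no_excess[OF p_inv q_inv mass] no_excess[OF q_inv p_inv mass[symmetric]] by simp
qed

section \<open>The lifted chain on words\<close>

lemma finite_words: "finite A \<Longrightarrow> finite (words A k)"
  unfolding words_def by (rule finite_lists_length_eq)

lemma Cons_butlast_in_words: "w \<in> words A k \<Longrightarrow> k \<ge> 1 \<Longrightarrow> a \<in> A \<Longrightarrow> a # butlast w \<in> words A k"
  by (auto simp: words_def dest: in_set_butlastD)

lemma tl_append_in_words: "u \<in> words A k \<Longrightarrow> k \<ge> 1 \<Longrightarrow> a \<in> A \<Longrightarrow> tl u @ [a] \<in> words A k"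
  by (cases u) (auto simp: words_def)

lemma last_in_alphabet: "w \<in> words A k \<Longrightarrow> k \<ge> 1 \<Longrightarrow> last w \<in> A"
  by (cases w rule: rev_cases) (auto simp: words_def)

lemma sum_lifted_matrix_out:
  assumes "finite A" "k \<ge> 1" "u \<in> words A k"
  shows "(\<Sum>w\<in>words A k. lifted_matrix Q u w) = (\<Sum>a\<in>A. Q u a)"
proof -
  have "(\<Sum>a\<in>A. Q u a) = (\<Sum>w\<in>(\<lambda>a. tl u @ [a]) ` A. lifted_matrix Q u w)"
    by (subst sum.reindex) (auto simp: inj_on_def lifted_matrix_def)
  also have "\<dots> = (\<Sum>w\<in>words A k. lifted_matrix Q u w)"
  proof (rule sum.mono_neutral_left)
    show "\<forall>w\<in>words A k - (\<lambda>a. tl u @ [a]) ` A. lifted_matrix Q u w = 0"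
    proof
      fix w assume w: "w \<in> words A k - (\<lambda>a. tl u @ [a]) ` A"
      then have "w \<noteq> []" "last w \<in> A" using assms last_in_alphabet[of w A k]
        by (auto simp: words_def)
      then have "tl u \<noteq> butlast w" using w append_butlast_last_id[of w] by (metis DiffD2 imageI)
      then show "lifted_matrix Q u w = 0" by (simp add: lifted_matrix_def)
    qed
  qed (use assms finite_words tl_append_in_words in auto)
  finally show ?thesis by simp
qed

lemma sum_lifted_matrix_in:
  assumes "finite A" "k \<ge> 1" "w \<in> words A k"
  shows "(\<Sum>u\<in>words A k. p u * lifted_matrix Q u w)
    = (\<Sum>a\<in>A. p (a # butlast w) * Q (a # butlast w) (last w))"
proof -
  have "(\<Sum>a\<in>A. p (a # butlast w) * Q (a # butlast w) (last w))
      = (\<Sum>u\<in>(\<lambda>a. a # butlast w) ` A. p u * lifted_matrix Q u w)"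
    by (subst sum.reindex) (auto simp: inj_on_def lifted_matrix_def)
  also have "\<dots> = (\<Sum>u\<in>words A k. p u * lifted_matrix Q u w)"
  proof (rule sum.mono_neutral_left)
    show "\<forall>u\<in>words A k - (\<lambda>a. a # butlast w) ` A. p u * lifted_matrix Q u w = 0"
    proof
      fix u assume u: "u \<in> words A k - (\<lambda>a. a # butlast w) ` A"
      then have "u \<noteq> []" "hd u \<in> A" using assms by (cases u; auto simp: words_def)+
      then have "tl u \<noteq> butlast w" using u by (metis DiffD2 imageI list.collapse)
      then show "p u * lifted_matrix Q u w = 0" by (simp add: lifted_matrix_def)
    qed
  qed (use assms finite_words Cons_butlast_in_words in auto)
  finally show ?thesis by simp
qed

lemma lifted_matrix_nonneg:
  assumes "row_stochastic A k Q" "k \<ge> 1" "u \<in> words A k" "w \<in> words A k"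
  shows "0 \<le> lifted_matrix Q u w"
  using assms last_in_alphabet[of w A k] by (auto simp: lifted_matrix_def row_stochastic_def)

lemma sum_lifted_matrix_eq_1:
  assumes "finite A" "row_stochastic A k Q" "k \<ge> 1" "u \<in> words A k"
  shows "(\<Sum>w\<in>words A k. lifted_matrix Q u w) = 1"
  using assms by (simp add: sum_lifted_matrix_out row_stochastic_def)

lemma edges_lifted_iff:
  assumes "k \<ge> 1" "u \<in> words A k"
  shows "(u, w) \<in> edges (words A k) (lifted_matrix Q)
    \<longleftrightarrow> (\<exists>a\<in>A. w = tl u @ [a] \<and> 0 < Q u a)" (is "?l \<longleftrightarrow> ?r")
proof
  assume ?l
  then have w: "w \<in> words A k" "tl u = butlast w" "0 < Q u (last w)"
    by (auto simp: edges_def lifted_matrix_def split: if_splits)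
  moreover have "w \<noteq> []" using w(1) assms by (auto simp: words_def)
  ultimately show ?r using last_in_alphabet[OF w(1) assms(1)] by (metis append_butlast_last_id)
next
  assume ?r
  then show ?l using assms tl_append_in_words by (auto simp: edges_def lifted_matrix_def)
qed

lemma invariant_distribution_unique:
  assumes fin: "finite A" and k: "k \<ge> 1" and Q: "row_stochastic A k Q"
    and reach: "\<And>u. u \<in> words A k \<Longrightarrow> (u, u0) \<in> (edges (words A k) (lifted_matrix Q))\<^sup>*"
    and \<mu>: "invariant_distribution A k Q \<mu>" and \<nu>: "invariant_distribution A k Q \<nu>"
  shows "\<mu> = \<nu>"
proof (rule pmf_eqI)
  fix w
  note D = invariant_distribution_def
  show "pmf \<mu> w = pmf \<nu> w"
  proof (cases "w \<in> words A k")
    case True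
    show ?thesis
    proof (rule invariant_unique[of "words A k" "lifted_matrix Q"])
      show "sum (pmf \<mu>) (words A k) = sum (pmf \<nu>) (words A k)"
        using \<mu> \<nu> sum_pmf_eq_1[OF finite_words[OF fin]] unfolding D by metis
      show "(u, u0) \<in> (edges (words A k) (lifted_matrix Q))\<^sup>*" if "u \<in> words A k" for u
        by (rule reach[OF that])
      show "pmf \<mu> v = (\<Sum>u\<in>words A k. pmf \<mu> u * lifted_matrix Q u v)"
        "pmf \<nu> v = (\<Sum>u\<in>words A k. pmf \<nu> u * lifted_matrix Q u v)" if "v \<in> words A k" for v
        using \<mu> \<nu> that unfolding D sum_lifted_matrix_in[OF fin k that] by blast+
    qed (auto simp: finite_words fin lifted_matrix_nonneg[OF Q k] True
        sum_lifted_matrix_eq_1[OF fin Q k])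
  next
    case False
    then have "w \<notin> set_pmf \<mu>" "w \<notin> set_pmf \<nu>" using \<mu> \<nu> by (auto simp: D)
    then show ?thesis by (simp add: set_pmf_iff)
  qed
qed

section \<open>Block probabilities\<close>

definition block_prob :: "'w measure \<Rightarrow> (nat \<Rightarrow> 'w \<Rightarrow> 'a) \<Rightarrow> nat \<Rightarrow> nat \<Rightarrow> 'a list \<Rightarrow> real" where
  "block_prob P V m n w = \<P>(\<omega> in P. block V m (m + n) \<omega> = w)"

lemma block_prob_nonneg: "0 \<le> block_prob P V m n w"
  by (simp add: block_prob_def)

lemma block_append: "block V m (m + Suc n) \<omega> = block V m (m + n) \<omega> @ [V (m + n) \<omega>]"
  by (simp add: block_def)

lemma tl_block: "tl (block V m (m + Suc n) \<omega>) = block V (Suc m) (Suc m + n) \<omega>"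
  by (simp add: block_def upt_conv_Cons del: upt_Suc)

lemma block_in_words: "process P A V \<Longrightarrow> \<omega> \<in> space P \<Longrightarrow> block V m (m + n) \<omega> \<in> words A n"
  by (auto simp: process_def block_def words_def dest!: measurable_space)

lemma block_event_measurable:
  assumes "process P A V"
  shows "{\<omega> \<in> space P. block V m (m + n) \<omega> = w} \<in> sets P"
proof (induction n arbitrary: w)
  case 0
  then show ?case by (auto simp: block_def)
next
  case (Suc n)
  have letter: "{\<omega> \<in> space P. V i \<omega> = a} \<in> sets P" for i a
  proof -
    have V: "V i \<in> P \<rightarrow>\<^sub>M count_space A" using assms by (simp add: process_def)
    have "{\<omega> \<in> space P. V i \<omega> = a} = V i -` ({a} \<inter> A) \<inter> space P"
      using measurable_space[OF V] by auto
    also have "\<dots> \<in> sets P" by (rule measurable_sets[OF V]) auto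
    finally show ?thesis .
  qed
  show ?case
  proof (cases w rule: rev_cases)
    case Nil
    then show ?thesis unfolding block_append by simp
  next
    case (snoc v a)
    have "{\<omega> \<in> space P. block V m (m + Suc n) \<omega> = w}
        = {\<omega> \<in> space P. block V m (m + n) \<omega> = v} \<inter> {\<omega> \<in> space P. V (m + n) \<omega> = a}"
      unfolding snoc block_append by auto
    then show ?thesis using Suc.IH letter by auto
  qed
qed

text \<open>The blocks of a given position and length take finitely many values. All marginalisations
  below are instances of this one decomposition.\<close>

lemma prob_block_event:
  assumes V: "process P A V" and fin: "finite A"
  shows "\<P>(\<omega> in P. F (block V m (m + n) \<omega>)) = (\<Sum>u | u \<in> words A n \<and> F u. block_prob P V m n u)"
proof -
  interpret prob_space P using V by (simp add: process_def)
  let ?B = "\<lambda>u. {\<omega> \<in> space P. block V m (m + n) \<omega> = u}"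
  let ?W = "{u \<in> words A n. F u}"
  have "{\<omega> \<in> space P. F (block V m (m + n) \<omega>)} = (\<Union>u\<in>?W. ?B u)"
    using block_in_words[OF V] by auto
  also have "prob \<dots> = (\<Sum>u\<in>?W. prob (?B u))"
    by (rule finite_measure_finite_Union)
       (auto simp: finite_words fin block_event_measurable[OF V] disjoint_family_on_def)
  finally show ?thesis by (simp add: block_prob_def)
qed

lemma sum_block_prob:
  assumes V: "process P A V" and fin: "finite A"
  shows "(\<Sum>u\<in>words A n. block_prob P V m n u) = 1"
  using prob_block_event[OF V fin, of "\<lambda>_. True" m n] V
  by (simp add: process_def prob_space.prob_space)

lemma block_prob_drop_first:
  assumes V: "process P A V" and fin: "finite A" and w: "w \<in> words A n"
  shows "block_prob P V (Suc m) n w = (\<Sum>a\<in>A. block_prob P V m (Suc n) (a # w))"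
proof -
  have "block_prob P V (Suc m) n w = \<P>(\<omega> in P. tl (block V m (m + Suc n) \<omega>) = w)"
    unfolding block_prob_def tl_block ..
  also have "\<dots> = (\<Sum>u | u \<in> words A (Suc n) \<and> tl u = w. block_prob P V m (Suc n) u)"
    by (rule prob_block_event[OF V fin])
  also have "{u. u \<in> words A (Suc n) \<and> tl u = w} = (\<lambda>a. a # w) ` A"
  proof (rule set_eqI)
    show "u \<in> {u. u \<in> words A (Suc n) \<and> tl u = w} \<longleftrightarrow> u \<in> (\<lambda>a. a # w) ` A" for u
      using w by (cases u) (auto simp: words_def)
  qed
  also have "sum (block_prob P V m (Suc n)) \<dots> = (\<Sum>a\<in>A. block_prob P V m (Suc n) (a # w))"
    by (subst sum.reindex) (auto simp: inj_on_def)
  finally show ?thesis .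
qed

lemma block_prob_append_le:
  assumes V: "process P A V"
  shows "block_prob P V m (Suc n) (w @ [a]) \<le> block_prob P V m n w"
proof -
  interpret prob_space P using V by (simp add: process_def)
  show ?thesis
    unfolding block_prob_def
    by (rule finite_measure_mono) (auto simp: block_append block_event_measurable[OF V] simp del: add_Suc_right)
qed

lemma block_prob_stationary:
  "stationary_process P A V \<Longrightarrow> w \<in> words A n \<Longrightarrow> block_prob P V m n w = block_prob P V 0 n w"
  by (simp add: stationary_process_def block_prob_def)

lemma block_prob_image:
  assumes X: "process P A X" and fin: "finite A"
  shows "block_prob P (\<lambda>n \<omega>. g (X n \<omega>)) m n w
    = (\<Sum>u | u \<in> words A n \<and> map g u = w. block_prob P X m n u)"
proof -
  have "block (\<lambda>n \<omega>. g (X n \<omega>)) a b \<omega> = map g (block X a b \<omega>)" for a b \<omega>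
    by (simp add: block_def)
  then show ?thesis
    using prob_block_event[OF X fin, of "\<lambda>u. map g u = w" m n] by (simp add: block_prob_def)
qed

lemma block_prob_image_ge:
  assumes X: "process P A X" and fin: "finite A" and u: "u \<in> words A n"
  shows "block_prob P X m n u \<le> block_prob P (\<lambda>n \<omega>. g (X n \<omega>)) m n (map g u)"
  unfolding block_prob_image[OF X fin]
  by (rule member_le_sum) (use u finite_words[OF fin] in \<open>auto simp: block_prob_nonneg\<close>)

lemma stationary_process_image:
  assumes X: "stationary_process P A X" and fin: "finite A" and g: "g \<in> A \<rightarrow> B"
  shows "stationary_process P B (\<lambda>n \<omega>. g (X n \<omega>))"
proof -
  have pX: "process P A X" using X by (simp add: stationary_process_def)
  have "process P B (\<lambda>n \<omega>. g (X n \<omega>))"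
    unfolding process_def
  proof (intro conjI allI)
    show "prob_space P" using pX by (simp add: process_def)
    fix n
    have "X n \<in> P \<rightarrow>\<^sub>M count_space A" using pX by (simp add: process_def)
    moreover have "g \<in> count_space A \<rightarrow>\<^sub>M count_space B" using g by simp
    ultimately show "(\<lambda>\<omega>. g (X n \<omega>)) \<in> P \<rightarrow>\<^sub>M count_space B"
      by (rule measurable_compose)
  qed
  moreover have "block_prob P (\<lambda>n \<omega>. g (X n \<omega>)) m n w = block_prob P (\<lambda>n \<omega>. g (X n \<omega>)) 0 n w" for m n w
    unfolding block_prob_image[OF pX fin]
    by (rule sum.cong) (auto intro: block_prob_stationary[OF X])
  ultimately show ?thesis
    by (simp add: stationary_process_def block_prob_def)
qed

section \<open>The Markov approximation of a stationary process\<close>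

lemma approx_matrix_mult:
  assumes V: "process P A V"
  shows "block_prob P V 0 k u * approx_matrix P A k V u a = block_prob P V 0 (Suc k) (u @ [a])"
proof (cases "block_prob P V 0 k u > 0")
  case True
  then show ?thesis by (simp add: approx_matrix_def block_prob_def)
next
  case False
  then have "block_prob P V 0 k u = 0" using block_prob_nonneg[of P V 0 k u] by simp
  moreover from this have "block_prob P V 0 (Suc k) (u @ [a]) = 0"
    using block_prob_append_le[OF V, of 0 k u a] block_prob_nonneg[of P V 0 "Suc k" "u @ [a]"] by simp
  ultimately show ?thesis by simp
qed

text \<open>A conditional probability times the probability of its condition is the probability of a
  block of length \<open>k + 1\<close>; summing over the first letter and shifting time back by one step gives
  invariance of the law of the first \<open>k\<close> letters.\<close>

lemma stationary_invariant_distribution_exists: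
  assumes V: "stationary_process P A V" and fin: "finite A" and k: "k \<ge> 1"
    and Q: "\<And>u a. u \<in> words A k \<Longrightarrow> a \<in> A \<Longrightarrow> Q u a = approx_matrix P A k V u a"
  shows "\<exists>\<mu>. invariant_distribution A k Q \<mu>"
proof -
  have pV: "process P A V" using V by (simp add: stationary_process_def)
  define f where "f w = (if w \<in> words A k then block_prob P V 0 k w else 0)" for w
  have f_nonneg: "0 \<le> f w" for w by (simp add: f_def block_prob_nonneg)
  have "(\<integral>\<^sup>+ w. ennreal (f w) \<partial>count_space UNIV) = (\<Sum>w\<in>words A k. ennreal (f w))"
    by (rule nn_integral_count_space') (auto simp: f_def finite_words fin)
  also have "\<dots> = ennreal (\<Sum>w\<in>words A k. f w)"
    by (rule sum_ennreal) (simp add: f_nonneg)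
  also have "(\<Sum>w\<in>words A k. f w) = 1"
    using sum_block_prob[OF pV fin, of 0 k] by (simp add: f_def)
  finally have pmf_f: "pmf (embed_pmf f) w = f w" for w
    using pmf_embed_pmf[of f w] f_nonneg by simp
  have "invariant_distribution A k Q (embed_pmf f)"
    unfolding invariant_distribution_def
  proof (intro conjI ballI)
    show "set_pmf (embed_pmf f) \<subseteq> words A k"
      by (auto simp: set_pmf_iff pmf_f f_def split: if_splits)
    fix w assume w: "w \<in> words A k"
    then have nonempty: "w \<noteq> []" using k by (auto simp: words_def)
    have "pmf (embed_pmf f) w = block_prob P V (Suc 0) k w"
      using block_prob_stationary[OF V w, of "Suc 0"] w by (simp add: pmf_f f_def)
    also have "\<dots> = (\<Sum>a\<in>A. block_prob P V 0 (Suc k) (a # w))"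
      by (rule block_prob_drop_first[OF pV fin w])
    also have "\<dots> = (\<Sum>a\<in>A. pmf (embed_pmf f) (a # butlast w) * Q (a # butlast w) (last w))"
    proof (rule sum.cong[OF refl])
      fix a assume a: "a \<in> A"
      have "block_prob P V 0 k (a # butlast w) * approx_matrix P A k V (a # butlast w) (last w)
          = block_prob P V 0 (Suc k) (a # w)"
        using approx_matrix_mult[OF pV, of k "a # butlast w" "last w"] nonempty by simp
      then show "block_prob P V 0 (Suc k) (a # w)
          = pmf (embed_pmf f) (a # butlast w) * Q (a # butlast w) (last w)"
        using Cons_butlast_in_words[OF w k a] last_in_alphabet[OF w k]
        by (simp add: pmf_f f_def Q)
    qed
    finally show "pmf (embed_pmf f) w
        = (\<Sum>a\<in>A. pmf (embed_pmf f) (a # butlast w) * Q (a # butlast w) (last w))" .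
  qed
  then show ?thesis ..
qed

text \<open>Fix a word \<open>w\<close> of positive probability. As long as the current word has probability zero,
  its row of the matrix is uniform, so the letters of \<open>w\<close> can be appended one after the other; after
  \<open>k\<close> such steps the current word is \<open>w\<close>.\<close>

lemma support_reachable:
  assumes V: "process P A V" and fin: "finite A" and k: "k \<ge> 1"
    and Q: "\<And>u a. u \<in> words A k \<Longrightarrow> a \<in> A \<Longrightarrow> Q u a = approx_matrix P A k V u a"
    and v: "v \<in> words A k"
  shows "\<exists>s\<in>words A k. 0 < block_prob P V 0 k s
    \<and> (v, s) \<in> (edges (words A k) (lifted_matrix Q))\<^sup>*"
proof (rule ccontr)
  let ?E = "edges (words A k) (lifted_matrix Q)"
  assume contra: "\<not> ?thesis"
  obtain w where w: "w \<in> words A k" "0 < block_prob P V 0 k w"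
    using sum_block_prob[OF V fin, of 0 k]
    by (metis sum_nonpos not_le zero_less_one)
  have "(v, drop i v @ take i w) \<in> ?E\<^sup>*" if "i \<le> k" for i
    using that
  proof (induction i)
    case 0
    then show ?case by simp
  next
    case (Suc i)
    let ?u = "drop i v @ take i w"
    have u: "?u \<in> words A k"
      using v w Suc.prems by (auto simp: words_def dest: in_set_dropD in_set_takeD)
    have a: "w ! i \<in> A" using w Suc.prems by (auto simp: words_def)
    have IH: "(v, ?u) \<in> ?E\<^sup>*" using Suc by simp
    then have "\<not> 0 < block_prob P V 0 k ?u" using contra u by blast
    then have "Q ?u (w ! i) = 1 / real (card A)"
      by (simp add: Q[OF u a] approx_matrix_def block_prob_def)
    moreover have "card A > 0" using a fin card_gt_0_iff by blast
    ultimately have "(?u, tl ?u @ [w ! i]) \<in> ?E"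
      using a edges_lifted_iff[OF k u] by simp
    moreover have "tl ?u @ [w ! i] = drop (Suc i) v @ take (Suc i) w"
      using v w Suc.prems by (simp add: words_def drop_Suc tl_drop take_Suc_conv_app_nth)
    ultimately show ?case using IH by simp
  qed
  from this[of k] have "(v, w) \<in> ?E\<^sup>*" using v w by (simp add: words_def)
  then show False using contra w by blast
qed

text \<open>Along edges of the approximation of \<open>X\<close> a path never leaves the support of the law of \<open>X\<close>, so
  each edge starting in the support comes from a block of \<open>k + 1\<close> letters of positive probability;
  the image of this block under \<open>g\<close> has positive probability as well.\<close>

lemma support_edge_image:
  assumes X: "stationary_process P A X" and fin: "finite A" and k: "k \<ge> 1"
    and g: "g \<in> A \<rightarrow> B"
    and R: "\<And>u a. u \<in> words A k \<Longrightarrow> a \<in> A \<Longrightarrow> R u a = approx_matrix P A k X u a"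
    and Q: "\<And>u b. u \<in> words B k \<Longrightarrow> b \<in> B
      \<Longrightarrow> Q u b = approx_matrix P B k (\<lambda>n \<omega>. g (X n \<omega>)) u b"
    and edge: "(u, w) \<in> edges (words A k) (lifted_matrix R)"
    and pos: "0 < block_prob P X 0 k u"
  shows "0 < block_prob P X 0 k w"
    and "(map g u, map g w) \<in> edges (words B k) (lifted_matrix Q)"
proof -
  let ?Y = "\<lambda>n \<omega>. g (X n \<omega>)"
  have pX: "process P A X" using X by (simp add: stationary_process_def)
  have pY: "process P B ?Y"
    using stationary_process_image[OF X fin g] by (simp add: stationary_process_def)
  have u: "u \<in> words A k" and w: "w \<in> words A k" using edge by (auto simp: edges_def)
  obtain a where a: "a \<in> A" "w = tl u @ [a]" "0 < R u a"
    using edge edges_lifted_iff[OF k u] by blast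
  have "u \<noteq> []" using u k by (auto simp: words_def)
  have "0 < block_prob P X 0 k u * approx_matrix P A k X u a"
    using pos a R[OF u a(1)] by simp
  then have pos_ua: "0 < block_prob P X 0 (Suc k) (u @ [a])"
    by (simp add: approx_matrix_mult[OF pX])
  also have "u @ [a] = hd u # w" using \<open>u \<noteq> []\<close> a(2) by (cases u) auto
  also have "block_prob P X 0 (Suc k) (hd u # w) \<le> (\<Sum>b\<in>A. block_prob P X 0 (Suc k) (b # w))"
    by (rule member_le_sum) (use u \<open>u \<noteq> []\<close> fin in \<open>auto simp: block_prob_nonneg words_def\<close>)
  also have "\<dots> = block_prob P X 0 k w"
    using block_prob_drop_first[OF pX fin w] block_prob_stationary[OF X w] by metis
  finally show "0 < block_prob P X 0 k w" .
  have "u @ [a] \<in> words A (Suc k)" using u a by (auto simp: words_def)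
  from pos_ua block_prob_image_ge[OF pX fin this, of 0 g]
  have "0 < block_prob P ?Y 0 (Suc k) (map g u @ [g a])" by simp
  then have "0 < block_prob P ?Y 0 k (map g u) * approx_matrix P B k ?Y (map g u) (g a)"
    by (simp add: approx_matrix_mult[OF pY])
  then have "0 < approx_matrix P B k ?Y (map g u) (g a)"
    using block_prob_nonneg[of P ?Y 0 k "map g u"]
    by (auto simp: zero_less_mult_iff)
  moreover have gu: "map g u \<in> words B k" and ga: "g a \<in> B"
    using u g a by (auto simp: words_def)
  ultimately have "0 < Q (map g u) (g a)" using Q by simp
  then show "(map g u, map g w) \<in> edges (words B k) (lifted_matrix Q)"
    unfolding edges_lifted_iff[OF k gu] using ga a(2) by (auto simp: map_tl)
qed

theorem corollary2:
  fixes k :: nat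
    and \<X> :: "'a set" and \<Y> :: "'b set"
    and g :: "'a \<Rightarrow> 'b"
    and P :: "'w measure" and X :: "nat \<Rightarrow> 'w \<Rightarrow> 'a" and Y :: "nat \<Rightarrow> 'w \<Rightarrow> 'b"
    and P\<^sub>Z :: "'v measure" and Z :: "nat \<Rightarrow> 'v \<Rightarrow> 'b" and Q :: "'b list \<Rightarrow> 'b \<Rightarrow> real"
    and P\<^sub>M :: "'u measure" and M :: "nat \<Rightarrow> 'u \<Rightarrow> 'a" and R :: "'a list \<Rightarrow> 'a \<Rightarrow> real"
  assumes "k \<ge> 1"
    and "finite \<X>" and "finite \<Y>"
    and "stationary_process P \<X> X"
    and "g \<in> \<X> \<rightarrow> \<Y>"
    and "Y = (\<lambda>n \<omega>. g (X n \<omega>))"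
    and "markov_approximation P \<Y> k Y P\<^sub>Z Q Z"
    and "markov_approximation P \<X> k X P\<^sub>M R M"
    and "\<exists>!C. recurrent_class (words \<X> k) (lifted_matrix R) C"
  shows "\<exists>!\<mu>. invariant_distribution \<Y> k Q \<mu>"
proof -
  note X = \<open>stationary_process P \<X> X\<close> and k = \<open>k \<ge> 1\<close> and g = \<open>g \<in> \<X> \<rightarrow> \<Y>\<close>
    and Y = \<open>Y = (\<lambda>n \<omega>. g (X n \<omega>))\<close>
  let ?EX = "edges (words \<X> k) (lifted_matrix R)"
  let ?EY = "edges (words \<Y> k) (lifted_matrix Q)"
  have pX: "process P \<X> X" using X by (simp add: stationary_process_def)
  have statY: "stationary_process P \<Y> Y"
    unfolding Y by (rule stationary_process_image[OF X \<open>finite \<X>\<close> g])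
  then have pY: "process P \<Y> Y" by (simp add: stationary_process_def)
  have Q: "row_stochastic \<Y> k Q" "\<And>u a. u \<in> words \<Y> k \<Longrightarrow> a \<in> \<Y> \<Longrightarrow> Q u a = approx_matrix P \<Y> k Y u a"
    and R: "row_stochastic \<X> k R" "\<And>u a. u \<in> words \<X> k \<Longrightarrow> a \<in> \<X> \<Longrightarrow> R u a = approx_matrix P \<X> k X u a"
    using assms(7,8) by (auto simp: markov_approximation_def markov_chain_def)
  have "\<exists>w\<in>words \<X> k. 0 < lifted_matrix R u w" if "u \<in> words \<X> k" for u
    using sum_lifted_matrix_eq_1[OF \<open>finite \<X>\<close> R(1) k that]
    by (metis sum_nonpos not_le zero_less_one)
  from single_recurrent_class_reachable[OF finite_words[OF \<open>finite \<X>\<close>]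
      lifted_matrix_nonneg[OF R(1) k] this assms(9)]
  obtain x0 where x0: "\<And>x. x \<in> words \<X> k \<Longrightarrow> (x, x0) \<in> ?EX\<^sup>+"
    by blast
  have reach: "(v, map g x0) \<in> ?EY\<^sup>*" if v: "v \<in> words \<Y> k" for v
  proof -
    obtain s where s: "0 < block_prob P Y 0 k s" "(v, s) \<in> ?EY\<^sup>*"
      using support_reachable[OF pY \<open>finite \<Y>\<close> k Q(2) v] by blast
    obtain u where u: "u \<in> words \<X> k" "map g u = s" "0 < block_prob P X 0 k u"
      using s(1) unfolding Y block_prob_image[OF pX \<open>finite \<X>\<close>]
      by (metis (mono_tags, lifting) mem_Collect_eq not_le sum_nonpos)
    have "(u, x0) \<in> ?EX\<^sup>*" using x0[OF u(1)] by (rule trancl_into_rtrancl)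
    then have "0 < block_prob P X 0 k x0 \<and> (map g u, map g x0) \<in> ?EY\<^sup>*"
    proof (induction rule: rtrancl_induct)
      case base
      then show ?case using u(3) by simp
    next
      case (step x y)
      with support_edge_image[OF X \<open>finite \<X>\<close> k g R(2) Q(2)[unfolded Y], of x y]
      show ?case by (meson rtrancl.rtrancl_into_rtrancl)
    qed
    then show ?thesis using s(2) u(2) rtrancl_trans by metis
  qed
  show ?thesis
    using stationary_invariant_distribution_exists[OF statY \<open>finite \<Y>\<close> k Q(2)]
      invariant_distribution_unique[OF \<open>finite \<Y>\<close> k Q(1) reach] by blast
qed

end
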